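(* Let $\mathcal{T}$ be a triangle with circumcircle $\mathcal{C}$, and let $D$ be a point lying neither on the side lines of $\mathcal{T}$ nor on $\mathcal{C}$. Let $\gamma_D$ be the i-conic of $\mathcal{T}$ focused in $D$, and let $\mathcal{E}_D$ be the pedal-circle of $\mathcal{T}$ with respect to $D$. Then: (1) $(\mathcal{C},\gamma_D)$ is a poristic pair (for $n=3$); (2) a triangle inscribed in $\mathcal{C}$ has pedal-circle $\mathcal{E}_D$ with respect to $D$ if and only if it is circumscribed to $\gamma_D$.
   Context: All objects are in the real Euclidean plane and triangles are non-degenerate. A "side" of a triangle means the full line through two of its vertices. A triangle is inscribed in a curve if its vertices lie on it, and circumscribed to a conic if its three sides are tangent to the conic; tangency is understood projectively, so an asymptote of a hyperbola counts as a tangent. The pedal triangle of a triangle with respect to a point $D$ (not on its circumcircle) has as vertices the feet of the perpendiculars from $D$ to the three sides; the pedal-circle with respect to $D$ is the circumcircle of the pedal triangle. For $D$ neither on the sides nor on the circumcircle of $\mathcal{T}$, the i-conic of $\mathcal{T}$ focused in $D$ is the (unique) conic having $D$ as a focus and tangent to the three sides of $\mathcal{T}$ (a circle centred at $D$ when $D$ is an incenter or excenter). A pair of conics $(\Gamma,\gamma)$ is poristic for $n=3$ if, whenever $A\in\Gamma$ is a point through which there are two distinct tangents to $\gamma$, and these tangents meet $\Gamma$ again at points $B$ and $C$ (with $A,B,C$ distinct), the line $BC$ is also tangent to $\gamma$. *)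

theory Defs
  imports "HOL-Analysis.Analysis"
begin

type_synonym plane = "real^2"

abbreviation line_through :: "plane \<Rightarrow> plane \<Rightarrow> plane set" where
  "line_through A B \<equiv> affine hull {A, B}"

definition is_line :: "plane set \<Rightarrow> bool" where
  "is_line l \<longleftrightarrow> (\<exists>A B. A \<noteq> B \<and> l = line_through A B)"

definition is_triangle :: "plane \<Rightarrow> plane \<Rightarrow> plane \<Rightarrow> bool" where
  "is_triangle A B C \<longleftrightarrow> \<not> collinear {A, B, C}"

definition is_circle :: "plane set \<Rightarrow> bool" where
  "is_circle S \<longleftrightarrow> (\<exists>c r. r > 0 \<and> S = sphere c r)"

definition circumcircle :: "plane \<Rightarrow> plane \<Rightarrow> plane \<Rightarrow> plane set" where
  "circumcircle A B C = (THE S. is_circle S \<and> A \<in> S \<and> B \<in> S \<and> C \<in> S)"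

definition foot :: "plane \<Rightarrow> plane set \<Rightarrow> plane" where
  "foot D l = (THE P. P \<in> l \<and> (\<forall>X\<in>l. \<forall>Y\<in>l. orthogonal (D - P) (X - Y)))"

definition pedal_circle :: "plane \<Rightarrow> plane \<Rightarrow> plane \<Rightarrow> plane \<Rightarrow> plane set" where
  "pedal_circle D A B C = circumcircle
     (foot D (line_through B C)) (foot D (line_through C A)) (foot D (line_through A B))"

text \<open>A conic is a nonempty set of affine points, the zero set of a nondegenerate quadratic
  form in homogeneous coordinates. The form is determined by the set up to a nonzero factor.\<close>

definition hom_coords :: "plane \<Rightarrow> real^3" where
  "hom_coords X = vector [X $ 1, X $ 2, 1]"

definition conic_matrix :: "real^3^3 \<Rightarrow> plane set \<Rightarrow> bool" where
  "conic_matrix M K \<longleftrightarrow> transpose M = M \<and> det M \<noteq> 0 \<and>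
     K = {X. hom_coords X \<bullet> (M *v hom_coords X) = 0}"

definition is_conic :: "plane set \<Rightarrow> bool" where
  "is_conic K \<longleftrightarrow> K \<noteq> {} \<and> (\<exists>M. conic_matrix M K)"

text \<open>The affine line \<open>l\<close> is the tangent of \<open>K\<close> at the projective point represented by
  \<open>P\<close>, i.e. the zero set of the gradient of the form at \<open>P\<close>. The point \<open>P\<close> may be at infinity,
  in which case \<open>l\<close> is an asymptote of a hyperbola.\<close>

definition tangent_to :: "plane set \<Rightarrow> plane set \<Rightarrow> bool" where
  "tangent_to l K \<longleftrightarrow> is_line l \<and> (\<exists>M P. conic_matrix M K \<and> P \<noteq> 0 \<and> P \<bullet> (M *v P) = 0 \<and>
     l = {X. hom_coords X \<bullet> (M *v P) = 0})"

text \<open>Focus and directrix, for both foci of ellipses and hyperbolas (an \<open>infdist\<close> condition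
  gives both branches of a hyperbola); a circle has its centre as focus.\<close>

definition has_focus :: "plane set \<Rightarrow> plane \<Rightarrow> bool" where
  "has_focus K D \<longleftrightarrow> (\<exists>r>0. K = sphere D r) \<or>
     (\<exists>d e. is_line d \<and> D \<notin> d \<and> e > 0 \<and> K = {X. dist X D = e * infdist X d})"

definition inscribed :: "plane \<Rightarrow> plane \<Rightarrow> plane \<Rightarrow> plane set \<Rightarrow> bool" where
  "inscribed A B C K \<longleftrightarrow> A \<in> K \<and> B \<in> K \<and> C \<in> K"

definition circumscribed :: "plane \<Rightarrow> plane \<Rightarrow> plane \<Rightarrow> plane set \<Rightarrow> bool" where
  "circumscribed A B C K \<longleftrightarrow>
     tangent_to (line_through B C) K \<and> tangent_to (line_through C A) K \<and>
     tangent_to (line_through A B) K"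

definition i_conic :: "plane \<Rightarrow> plane \<Rightarrow> plane \<Rightarrow> plane \<Rightarrow> plane set" where
  "i_conic D A B C = (THE K. is_conic K \<and> has_focus K D \<and> circumscribed A B C K)"

definition poristic3 :: "plane set \<Rightarrow> plane set \<Rightarrow> bool" where
  "poristic3 \<Gamma> \<gamma> \<longleftrightarrow> is_conic \<Gamma> \<and> is_conic \<gamma> \<and>
     (\<forall>A B C l m. A \<in> \<Gamma> \<and> tangent_to l \<gamma> \<and> tangent_to m \<gamma> \<and> l \<noteq> m \<and> A \<in> l \<and> A \<in> m \<and>
        B \<in> l \<inter> \<Gamma> \<and> C \<in> m \<inter> \<Gamma> \<and> A \<noteq> B \<and> A \<noteq> C \<and> B \<noteq> C \<longrightarrow>
        tangent_to (line_through B C) \<gamma>)"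

end

theory Submission
  imports Defs "HOL-Computational_Algebra.Polynomial"
begin

text \<open>
  A tangent of the i-conic is recognised by the foot of its perpendicular from the focus: a line
  touches \<open>\<gamma>\<^sub>D\<close> if and only if the foot of \<open>D\<close> on it lies on the pedal circle \<open>\<E>\<^sub>D\<close>. Indeed, polar
  duality about the focus turns a conic into a circle (\<open>tangent_to_focal_conic\<close>), and inversion about
  \<open>D\<close> carries the dual point of a line to the foot of \<open>D\<close> on that line, hence the dual circle to a
  circle of feet (\<open>tangent_to_pedal_conic_iff\<close>). Such a conic is determined by three of its tangents
  (\<open>tangent_lines_determine_focal_conic\<close>), so it is the i-conic.

  The second claim follows at once. A triangle inscribed in \<open>\<C>\<close> has a non-degenerate pedal triangle,
  since \<open>D\<close> is not on \<open>\<C>\<close>, so that its pedal circle is \<open>\<E>\<^sub>D\<close> if and only if the three feet lie on \<open>\<E>\<^sub>D\<close>,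
  that is, if and only if its three sides are tangent to \<open>\<gamma>\<^sub>D\<close>.

  For the porism let \<open>\<C>\<close> be the unit circle of the complex plane and \<open>d\<close> the coordinate of \<open>D\<close>. The
  isogonal conjugate \<open>d'\<close> of \<open>d\<close> in an inscribed triangle with vertices \<open>a\<close>, \<open>b\<close>, \<open>c\<close> is given by
  \<open>a + b + c - a * b * c * cnj d * cnj d' = d + d'\<close>, and the pedal circle is determined by \<open>d\<close> and \<open>d'\<close>
  alone. The condition that a chord has its foot on this circle is a symmetric polynomial equation
  between its endpoints, quadratic in each (\<open>chord_form\<close>). It follows from the displayed relation
  (\<open>conjugate_points_chord_form\<close>). Conversely, if the chords \<open>a b\<close> and \<open>a c\<close> satisfy it and \<open>b \<noteq> c\<close>,
  then Vieta's formulas for the two roots \<open>b\<close>, \<open>c\<close> reproduce the relation (\<open>chord_form_porism\<close>). As the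
  relation is symmetric in \<open>a\<close>, \<open>b\<close>, \<open>c\<close>, the chord \<open>b c\<close> satisfies the equation too.
\<close>

section \<open>Lines and circles in the plane\<close>

lemma inner_plane: "(x::plane) \<bullet> y = x $ 1 * y $ 1 + x $ 2 * y $ 2"
  by (simp add: inner_vec_def sum_2)

lemma plane_eqI: "(x::plane) $ 1 = y $ 1 \<Longrightarrow> x $ 2 = y $ 2 \<Longrightarrow> x = y"
  by (simp add: vec_eq_iff forall_2)

text \<open>The quarter turn: pairing with \<open>perp v\<close> is the cross product with \<open>v\<close>, which turns
  collinearity into one polynomial equation.\<close>

definition perp :: "plane \<Rightarrow> plane" where
  "perp v = vector [- v $ 2, v $ 1]"

lemma perp_nth [simp]: "perp v $ 1 = - v $ 2" "perp v $ 2 = v $ 1"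
  by (simp_all add: perp_def)

lemma perp_eq_0_iff [simp]: "perp v = 0 \<longleftrightarrow> v = 0"
  by (auto simp: vec_eq_iff forall_2)

lemma inner_perp_eq_0_iff:
  assumes "v \<noteq> 0"
  shows "perp v \<bullet> x = 0 \<longleftrightarrow> (\<exists>t. x = t *\<^sub>R v)"
proof
  assume *: "perp v \<bullet> x = 0"
  have v: "v \<bullet> v \<noteq> 0" using assms by simp
  have "x = ((x \<bullet> v) / (v \<bullet> v)) *\<^sub>R v"
  proof -
    have "(v \<bullet> v) * x $ 1 = (x \<bullet> v) * v $ 1" "(v \<bullet> v) * x $ 2 = (x \<bullet> v) * v $ 2"
      using * unfolding inner_plane perp_nth by algebra+
    then show ?thesis using v by (intro plane_eqI) (simp_all add: field_simps)
  qed
  then show "\<exists>t. x = t *\<^sub>R v" by blast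
qed (auto simp: inner_plane)

lemma line_through_eq:
  assumes "A \<noteq> B"
  shows "line_through A B = {X. perp (B - A) \<bullet> (X - A) = 0}"
proof -
  have "X \<in> line_through A B \<longleftrightarrow> (\<exists>t. X - A = t *\<^sub>R (B - A))" for X
  proof
    assume "X \<in> line_through A B"
    then obtain u v where "u + v = 1" "X = u *\<^sub>R A + v *\<^sub>R B" by (auto simp: affine_hull_2)
    then have "X - A = v *\<^sub>R (B - A)"
      by (simp add: algebra_simps flip: scaleR_add_left)
    then show "\<exists>t. X - A = t *\<^sub>R (B - A)" by blast
  next
    assume "\<exists>t. X - A = t *\<^sub>R (B - A)"
    then obtain t where "X - A = t *\<^sub>R (B - A)" by blast
    then have "X = (1 - t) *\<^sub>R A + t *\<^sub>R B" by (simp add: algebra_simps)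
    then show "X \<in> line_through A B" unfolding affine_hull_2
      by (intro CollectI exI[of _ "1 - t"] exI[of _ t]) simp
  qed
  then show ?thesis using assms by (auto simp: inner_perp_eq_0_iff)
qed

lemma collinear_iff_perp:
  fixes A B C :: plane
  shows "collinear {A, B, C} \<longleftrightarrow> A = B \<or> perp (B - A) \<bullet> (C - A) = 0"
proof (cases "A = B")
  case False
  have "collinear {A, B, C} \<longleftrightarrow> C \<in> line_through A B"
    using False collinear_3_affine_hull by blast
  then show ?thesis using False by (simp add: line_through_eq)
qed simp

text \<open>An affine function that takes the same value at three non-collinear points is constant. The
  uniqueness of the circumcircle and that of the i-conic both rest on this.\<close>

lemma noncollinear_inner_eq:
  fixes A B C n :: plane
  assumes "\<not> collinear {A, B, C}" "n \<bullet> A = n \<bullet> B" "n \<bullet> A = n \<bullet> C"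
  shows "n = 0"
proof -
  define p where "p = perp (B - A) \<bullet> (C - A)"
  have p: "p \<noteq> 0" using assms(1) by (auto simp: collinear_iff_perp p_def)
  have "p * n $ 1 = 0" "p * n $ 2 = 0"
    using assms(2,3) unfolding p_def inner_plane by (simp_all, algebra+)
  then show ?thesis using p by (simp add: plane_eqI)
qed

lemma foot_eqI:
  assumes "P \<in> l" "l = line_through A B" "A \<noteq> B" "(D - P) \<bullet> (B - A) = 0"
  shows "foot D l = P"
  unfolding foot_def
proof (rule the_equality)
  have *: "X \<in> l \<Longrightarrow> \<exists>t. X - A = t *\<^sub>R (B - A)" for X
    using assms(2,3) by (simp add: line_through_eq inner_perp_eq_0_iff)
  have 0: "(D - P) \<bullet> (X - Y) = 0" if "X \<in> l" "Y \<in> l" for X Y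
  proof -
    from *[OF that(1)] *[OF that(2)] obtain s t where
      "X - A = t *\<^sub>R (B - A)" "Y - A = s *\<^sub>R (B - A)" by blast
    moreover have "X - Y = (X - A) - (Y - A)" by simp
    ultimately have "X - Y = (t - s) *\<^sub>R (B - A)" by (simp only: scaleR_left_diff_distrib)
    then show ?thesis using assms(4) by simp
  qed
  then show "P \<in> l \<and> (\<forall>X\<in>l. \<forall>Y\<in>l. orthogonal (D - P) (X - Y))"
    using assms(1) by (simp add: orthogonal_def)
  fix Q assume Q: "Q \<in> l \<and> (\<forall>X\<in>l. \<forall>Y\<in>l. orthogonal (D - Q) (X - Y))"
  have "(D - P) \<bullet> (Q - P) = 0" "(D - Q) \<bullet> (Q - P) = 0"
    using Q 0 assms(1) by (auto simp: orthogonal_def)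
  then have "(Q - P) \<bullet> (Q - P) = 0" by (simp add: inner_diff inner_commute)
  then show "Q = P" by simp
qed

text \<open>A line meets a circle at most twice: along the line the equation of the circle is quadratic
  in the parameter, with one root at \<open>t = 0\<close>.\<close>

lemma sphere_noncollinear:
  fixes A B C :: plane
  assumes "A \<in> sphere c r" "B \<in> sphere c r" "C \<in> sphere c r" "A \<noteq> B" "A \<noteq> C" "B \<noteq> C"
  shows "\<not> collinear {A, B, C}"
proof
  assume "collinear {A, B, C}"
  then obtain t where t: "C - A = t *\<^sub>R (B - A)"
    using assms(4) by (auto simp: collinear_iff_perp inner_perp_eq_0_iff)
  have n: "(X - c) \<bullet> (X - c) = r\<^sup>2" if "X \<in> sphere c r" for X
    using that by (metis mem_sphere dist_commute dist_norm power2_norm_eq_inner)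
  have shift: "2 * ((A - c) \<bullet> z) + z \<bullet> z = 0" if "A + z \<in> sphere c r" for z
  proof -
    have "((A - c) + z) \<bullet> ((A - c) + z) = r\<^sup>2"
      using n[OF that] by (simp add: algebra_simps)
    then show ?thesis using n[OF assms(1)] by (simp add: inner_add_left inner_add_right inner_commute)
  qed
  have C: "A + t *\<^sub>R (B - A) = C" by (simp flip: t)
  define x y where "x = (A - c) \<bullet> (B - A)" and "y = (B - A) \<bullet> (B - A)"
  have "2 * x + y = 0"
    using shift[of "B - A"] assms(2) by (simp add: x_def y_def)
  moreover have "2 * t * x + t * t * y = 0"
    using shift[of "t *\<^sub>R (B - A)"] C assms(3) by (simp add: x_def y_def mult.assoc)
  ultimately have "t * (t - 1) * y = 0" by algebra
  moreover have "y \<noteq> 0" using assms(4) by (simp add: y_def)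
  ultimately have "t = 0 \<or> t = 1" by simp
  then show False using t assms(5,6) by auto
qed

text \<open>Subtracting the equations of the two circles leaves an affine function that vanishes at
  \<open>A\<close>, \<open>B\<close>, \<open>C\<close>; its linear part is twice the difference of the centres.\<close>

lemma sphere_unique:
  fixes A B C :: plane
  assumes nc: "\<not> collinear {A, B, C}" and "r > 0" "r' > 0"
    and S: "A \<in> sphere c r" "B \<in> sphere c r" "C \<in> sphere c r"
    and S': "A \<in> sphere c' r'" "B \<in> sphere c' r'" "C \<in> sphere c' r'"
  shows "sphere c r = sphere c' r'"
proof -
  have n: "X \<bullet> X - 2 * (c \<bullet> X) + c \<bullet> c = r\<^sup>2" if "X \<in> sphere c r" for X :: plane and c r
  proof -
    have "(X - c) \<bullet> (X - c) = r\<^sup>2"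
      using that by (metis mem_sphere dist_commute dist_norm power2_norm_eq_inner)
    then show ?thesis by (simp add: inner_diff inner_commute)
  qed
  have "c - c' = 0"
    by (rule noncollinear_inner_eq[OF nc])
       (use n[OF S(1)] n[OF S(2)] n[OF S(3)] n[OF S'(1)] n[OF S'(2)] n[OF S'(3)] in
         \<open>simp_all add: inner_diff_left\<close>)
  then show ?thesis using S(1) S'(1) by auto
qed

lemma circumcircle_eq_sphere:
  fixes A B C :: plane
  assumes "\<not> collinear {A, B, C}" "r > 0" "A \<in> sphere c r" "B \<in> sphere c r" "C \<in> sphere c r"
  shows "circumcircle A B C = sphere c r"
  unfolding circumcircle_def
proof (rule the_equality)
  show "is_circle (sphere c r) \<and> A \<in> sphere c r \<and> B \<in> sphere c r \<and> C \<in> sphere c r"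
    using assms by (auto simp: is_circle_def)
  fix S assume "is_circle S \<and> A \<in> S \<and> B \<in> S \<and> C \<in> S"
  then obtain c' r' where "r' > 0" "S = sphere c' r'" "A \<in> S" "B \<in> S" "C \<in> S"
    unfolding is_circle_def by blast
  then show "S = sphere c r" using sphere_unique[OF assms(1), of r' r c' c] assms by simp
qed

lemma circumcircle_exists:
  fixes A B C :: plane
  assumes "\<not> collinear {A, B, C}"
  obtains c r where "r > 0" "A \<in> sphere c r" "B \<in> sphere c r" "C \<in> sphere c r"
proof -
  define p where "p = perp (B - A) \<bullet> (C - A)"
  have p: "p \<noteq> 0" using assms by (auto simp: collinear_iff_perp p_def)
  define \<beta> \<gamma> where "\<beta> = (B - A) \<bullet> (B - A)" and "\<gamma> = (C - A) \<bullet> (C - A)"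
  \<comment> \<open>Cramer's rule for the two perpendicular bisectors; \<open>A + k\<close> is the circumcentre.\<close>
  define k where "k = (1 / (2 * p)) *\<^sub>R (\<gamma> *\<^sub>R perp (B - A) - \<beta> *\<^sub>R perp (C - A))"
  have q: "perp (C - A) \<bullet> (B - A) = - p" "perp (B - A) \<bullet> (B - A) = 0" "perp (C - A) \<bullet> (C - A) = 0"
    unfolding p_def inner_plane by (simp_all add: algebra_simps)
  have kB: "2 * (k \<bullet> (B - A)) = \<beta>" and kC: "2 * (k \<bullet> (C - A)) = \<gamma>"
    using p by (simp_all add: k_def inner_diff_left q flip: p_def)
  have eq: "dist (A + k) X = norm k" if "2 * (k \<bullet> (X - A)) = (X - A) \<bullet> (X - A)" for X
  proof -
    have "(k - (X - A)) \<bullet> (k - (X - A)) = k \<bullet> k"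
      using that by (simp add: inner_diff inner_commute)
    then have "norm (k - (X - A)) = norm k" by (simp add: norm_eq)
    then show ?thesis by (simp add: dist_norm algebra_simps)
  qed
  have "A \<noteq> B" using assms by auto
  then have "\<beta> \<noteq> 0" by (simp add: \<beta>_def)
  then have "k \<noteq> 0" using kB by auto
  then show thesis
    using that[of "norm k" "A + k"] eq[of A] eq[of B] eq[of C] kB kC
    by (simp add: \<beta>_def \<gamma>_def)
qed

lemma line_eq_line_through:
  assumes "is_line l" "A \<in> l" "B \<in> l" "A \<noteq> B"
  shows "l = line_through A B"
proof -
  obtain U V where UV: "U \<noteq> V" "l = line_through U V" using assms(1) by (auto simp: is_line_def)
  define n where "n = perp (V - U)"
  have l: "X \<in> l \<longleftrightarrow> n \<bullet> (X - U) = 0" for X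
    using UV by (simp add: line_through_eq n_def)
  obtain s t where "A - U = s *\<^sub>R (V - U)" "B - U = t *\<^sub>R (V - U)"
    using assms(2,3) UV unfolding line_through_eq[OF UV(1)]
    by (auto simp: inner_perp_eq_0_iff)
  moreover have "B - A = (B - U) - (A - U)" by simp
  ultimately have BA: "B - A = (t - s) *\<^sub>R (V - U)" by (simp only: scaleR_left_diff_distrib)
  then have "t - s \<noteq> 0" using assms(4) by auto
  moreover have "perp (B - A) = (t - s) *\<^sub>R n"
    unfolding BA n_def by (rule plane_eqI) (simp_all add: algebra_simps)
  moreover have "n \<bullet> (X - U) = n \<bullet> (X - A)" for X
    using assms(2) l[of A] by (simp add: inner_diff_right)
  ultimately have "X \<in> l \<longleftrightarrow> perp (B - A) \<bullet> (X - A) = 0" for X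
    by (simp add: l)
  then show ?thesis using line_through_eq[OF assms(4)] by blast
qed

section \<open>Conics with a given focus\<close>

text \<open>The polar of the point \<open>D + u\<close> in the unit circle around \<open>D\<close>: this represents the lines that
  avoid \<open>D\<close> by the nonzero vectors.\<close>

definition polar_line :: "plane \<Rightarrow> plane \<Rightarrow> plane set" where
  "polar_line D u = {X. u \<bullet> (X - D) = 1}"

text \<open>A uniform equation of all conics with focus \<open>D\<close>. For \<open>w \<noteq> 0\<close> the directrix is the polar line of
  \<open>w\<close> and the eccentricity is \<open>norm w / \<rho>\<close>; for \<open>w = 0\<close> it is the circle of radius \<open>1 / \<rho>\<close>. The
  parameters are those of the polar dual of the conic, the circle with centre \<open>w\<close> and radius
  \<open>\<rho>\<close>.\<close>

definition focal_conic :: "plane \<Rightarrow> plane \<Rightarrow> real \<Rightarrow> plane set" where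
  "focal_conic D w \<rho> = {X. \<rho> * dist X D = \<bar>w \<bullet> (X - D) - 1\<bar>}"

lemma perp_perp [simp]: "perp (perp v) = - v"
  by (simp add: plane_eqI)

lemma inner_perp_self [simp]: "perp v \<bullet> v = 0" "v \<bullet> perp v = 0"
  by (simp_all add: inner_plane)

lemma polar_line_through:
  assumes "u \<noteq> 0"
  shows "polar_line D u = line_through (D + (1 / (u \<bullet> u)) *\<^sub>R u) (D + (1 / (u \<bullet> u)) *\<^sub>R u + perp u)"
proof -
  have u: "u \<bullet> u \<noteq> 0" using assms by simp
  have ne: "D + (1 / (u \<bullet> u)) *\<^sub>R u \<noteq> D + (1 / (u \<bullet> u)) *\<^sub>R u + perp u"
    using assms by simp
  have "u \<bullet> (X - D) = 1 \<longleftrightarrow> - u \<bullet> (X - (D + (1 / (u \<bullet> u)) *\<^sub>R u)) = 0" for X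
    using u by (simp add: inner_diff_right inner_add_right) argo
  then show ?thesis unfolding line_through_eq[OF ne] polar_line_def
    by simp
qed

lemma is_line_polar_line: "u \<noteq> 0 \<Longrightarrow> is_line (polar_line D u)"
  unfolding is_line_def using polar_line_through[of u D]
  by (metis add_cancel_right_right perp_eq_0_iff)

lemma polar_line_inj:
  assumes "polar_line D u = polar_line D v" "u \<noteq> 0" "v \<noteq> 0"
  shows "u = v"
proof -
  have u: "u \<bullet> u \<noteq> 0" using assms by simp
  have "D + (1 / (u \<bullet> u)) *\<^sub>R u + t *\<^sub>R perp u \<in> polar_line D u" for t
    using u by (simp add: polar_line_def inner_add_right)
  then have *: "v \<bullet> ((1 / (u \<bullet> u)) *\<^sub>R u + t *\<^sub>R perp u) = 1" for t
    unfolding assms(1) by (simp add: polar_line_def)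
  have 1: "v \<bullet> u = u \<bullet> u" using *[of 0] u by (simp add: field_simps)
  have 2: "v \<bullet> perp u = 0" using *[of 1] *[of 0] unfolding inner_add_right inner_scaleR_right by linarith
  have "(v - u) \<bullet> u = 0" "(v - u) \<bullet> perp u = 0" using 1 2 by (simp_all add: inner_diff_left)
  then have "(u \<bullet> u) * (v - u) $ 1 = 0" "(u \<bullet> u) * (v - u) $ 2 = 0"
    unfolding inner_plane perp_nth by algebra+
  then show ?thesis using u by (simp add: plane_eqI)
qed

lemma line_avoiding_point:
  assumes "is_line l" "D \<notin> l"
  obtains u where "u \<noteq> 0" "l = polar_line D u"
proof -
  obtain A B where AB: "A \<noteq> B" "l = line_through A B" using assms by (auto simp: is_line_def)
  define n m where "n = perp (B - A)" and "m = n \<bullet> (A - D)"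
  have l: "l = {X. n \<bullet> (X - A) = 0}" using AB by (simp add: line_through_eq n_def)
  have m: "m \<noteq> 0" using assms(2) by (simp add: l m_def inner_diff_right)
  have "n \<bullet> (X - A) = 0 \<longleftrightarrow> ((1 / m) *\<^sub>R n) \<bullet> (X - D) = 1" for X
  proof -
    have "n \<bullet> (X - A) = n \<bullet> (X - D) - m" by (simp add: m_def inner_diff_right)
    then show ?thesis using m by (auto simp: field_simps)
  qed
  then have "l = polar_line D ((1 / m) *\<^sub>R n)" by (simp add: l polar_line_def)
  moreover have "(1 / m) *\<^sub>R n \<noteq> 0" using m AB(1) by (simp add: n_def)
  ultimately show thesis using that by blast
qed

text \<open>The foot of the perpendicular from \<open>D\<close> is the inverse of \<open>D + u\<close> in the unit circle around
  \<open>D\<close>. This is how polar duals become pedal circles.\<close>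

lemma foot_polar_line:
  assumes "u \<noteq> 0"
  shows "foot D (polar_line D u) = D + (1 / (u \<bullet> u)) *\<^sub>R u"
proof (rule foot_eqI[OF _ polar_line_through[OF assms]])
  show "D + (1 / (u \<bullet> u)) *\<^sub>R u \<in> polar_line D u"
    using assms by (simp add: polar_line_def)
qed (use assms in simp_all)

lemma foot_of_mem:
  assumes "is_line l" "D \<in> l"
  shows "foot D l = D"
proof -
  obtain A B where "A \<noteq> B" "l = line_through A B" using assms by (auto simp: is_line_def)
  then show ?thesis using foot_eqI[of D l A B D] assms by simp
qed

lemma infdist_polar_line:
  assumes "u \<noteq> 0"
  shows "infdist X (polar_line D u) = \<bar>u \<bullet> (X - D) - 1\<bar> / norm u"
proof (rule antisym)
  have u: "u \<bullet> u \<noteq> 0" using assms by simp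
  define s where "s = u \<bullet> (X - D) - 1"
  define F where "F = X - (s / (u \<bullet> u)) *\<^sub>R u"
  have F: "F \<in> polar_line D u"
    using u by (simp add: F_def polar_line_def s_def inner_diff_right)
  have "dist X F = \<bar>s\<bar> / norm u"
    using assms by (simp add: F_def dist_norm power2_norm_eq_inner[symmetric] power2_eq_square)
  then show "infdist X (polar_line D u) \<le> \<bar>u \<bullet> (X - D) - 1\<bar> / norm u"
    using infdist_le[OF F, of X] by (simp add: s_def)
  have "\<bar>s\<bar> / norm u \<le> dist X Y" if "Y \<in> polar_line D u" for Y
  proof -
    have "s = u \<bullet> (X - Y)" using that by (simp add: s_def polar_line_def inner_diff_right)
    then show ?thesis using Cauchy_Schwarz_ineq2[of u "X - Y"] assms
      by (simp add: dist_norm field_simps)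
  qed
  then show "\<bar>u \<bullet> (X - D) - 1\<bar> / norm u \<le> infdist X (polar_line D u)"
    using F unfolding s_def by (subst infdist_notempty) (auto intro!: cINF_greatest)
qed

lemma has_focus_iff_focal_conic:
  "has_focus K D \<longleftrightarrow> (\<exists>w \<rho>. \<rho> > 0 \<and> K = focal_conic D w \<rho>)"
proof
  assume "has_focus K D"
  then consider r where "r > 0" "K = sphere D r"
    | d e where "is_line d" "D \<notin> d" "e > 0" "K = {X. dist X D = e * infdist X d}"
    unfolding has_focus_def by blast
  then show "\<exists>w \<rho>. \<rho> > 0 \<and> K = focal_conic D w \<rho>"
  proof cases
    case 1
    then have "K = focal_conic D 0 (1 / r)"
      by (auto simp: focal_conic_def dist_commute field_simps)
    then show ?thesis using 1 by (intro exI[of _ 0] exI[of _ "1 / r"]) simp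
  next
    case 2
    obtain u where u: "u \<noteq> 0" "d = polar_line D u" using line_avoiding_point 2 by blast
    have "dist X D = e * infdist X d \<longleftrightarrow> norm u / e * dist X D = \<bar>u \<bullet> (X - D) - 1\<bar>" for X
      unfolding u(2) infdist_polar_line[OF u(1)] using u(1) 2(3) by (simp add: field_simps)
    then show ?thesis using 2 u(1)
      by (intro exI[of _ u] exI[of _ "norm u / e"]) (simp add: focal_conic_def)
  qed
next
  assume "\<exists>w \<rho>. \<rho> > 0 \<and> K = focal_conic D w \<rho>"
  then obtain w \<rho> where \<rho>: "\<rho> > 0" and K: "K = focal_conic D w \<rho>" by blast
  show "has_focus K D"
  proof (cases "w = 0")
    case True
    then have "K = sphere D (1 / \<rho>)"
      using \<rho> unfolding K by (auto simp: focal_conic_def dist_commute field_simps)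
    then show ?thesis using \<rho> unfolding has_focus_def by (metis divide_pos_pos zero_less_one)
  next
    case False
    have "\<rho> * dist X D = \<bar>w \<bullet> (X - D) - 1\<bar> \<longleftrightarrow> dist X D = norm w / \<rho> * infdist X (polar_line D w)" for X
      unfolding infdist_polar_line[OF False] using False \<rho> by (simp add: field_simps)
    then have "K = {X. dist X D = norm w / \<rho> * infdist X (polar_line D w)}"
      by (simp add: K focal_conic_def)
    moreover have "D \<notin> polar_line D w" by (simp add: polar_line_def)
    ultimately show ?thesis unfolding has_focus_def
      using is_line_polar_line[OF False] False \<rho> by (metis divide_pos_pos zero_less_norm_iff)
  qed
qed

section \<open>Tangents of a conic in polar duality about its focus\<close>

text \<open>In homogeneous coordinates, \<open>affine_part\<close> moves \<open>D\<close> to the origin and \<open>polar_form\<close> extends the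
  function \<open>w \<bullet> (X - D) - 1\<close>. Together they are linear coordinates on homogeneous space in which
  the focal conic becomes the standard circular cone \<open>\<rho>\<^sup>2 * (y \<bullet> y) = s\<^sup>2\<close>.\<close>

definition affine_part :: "plane \<Rightarrow> real^3 \<Rightarrow> plane" where
  "affine_part D P = vector [P $ 1 - P $ 3 * D $ 1, P $ 2 - P $ 3 * D $ 2]"

definition polar_form :: "plane \<Rightarrow> plane \<Rightarrow> real^3 \<Rightarrow> real" where
  "polar_form D w P = w \<bullet> affine_part D P - P $ 3"

definition focal_form :: "plane \<Rightarrow> plane \<Rightarrow> real \<Rightarrow> real^3 \<Rightarrow> real^3 \<Rightarrow> real" where
  "focal_form D w \<rho> P Q =
     \<rho>\<^sup>2 * (affine_part D P \<bullet> affine_part D Q) - polar_form D w P * polar_form D w Q"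

definition of_focal_coords :: "plane \<Rightarrow> plane \<Rightarrow> plane \<Rightarrow> real \<Rightarrow> real^3" where
  "of_focal_coords D w y s =
     (let t = w \<bullet> y - s in vector [y $ 1 + t * D $ 1, y $ 2 + t * D $ 2, t])"

lemma vec3_eqI: "(x::real^3) $ 1 = y $ 1 \<Longrightarrow> x $ 2 = y $ 2 \<Longrightarrow> x $ 3 = y $ 3 \<Longrightarrow> x = y"
  by (simp add: vec_eq_iff forall_3)

lemma affine_part_nth [simp]:
  "affine_part D P $ 1 = P $ 1 - P $ 3 * D $ 1" "affine_part D P $ 2 = P $ 2 - P $ 3 * D $ 2"
  by (simp_all add: affine_part_def)

lemma focal_coords_inverse [simp]:
  "affine_part D (of_focal_coords D w y s) = y"
  "polar_form D w (of_focal_coords D w y s) = s"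
  "of_focal_coords D w (affine_part D P) (polar_form D w P) = P"
proof -
  show y: "affine_part D (of_focal_coords D w y s) = y"
    by (rule plane_eqI) (simp_all add: of_focal_coords_def Let_def)
  show "polar_form D w (of_focal_coords D w y s) = s"
    unfolding polar_form_def y by (simp add: of_focal_coords_def Let_def)
  show "of_focal_coords D w (affine_part D P) (polar_form D w P) = P"
    by (rule vec3_eqI) (simp_all add: of_focal_coords_def polar_form_def Let_def)
qed

lemma hom_coords_nth [simp]:
  "hom_coords X $ 1 = X $ 1" "hom_coords X $ 2 = X $ 2" "hom_coords X $ 3 = 1"
  by (simp_all add: hom_coords_def)

lemma hom_coords_focal [simp]:
  "affine_part D (hom_coords X) = X - D"
  "polar_form D w (hom_coords X) = w \<bullet> (X - D) - 1"
proof -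
  show "affine_part D (hom_coords X) = X - D" by (rule plane_eqI) simp_all
  then show "polar_form D w (hom_coords X) = w \<bullet> (X - D) - 1" by (simp add: polar_form_def)
qed

lemma mem_focal_conic_iff:
  assumes "\<rho> > 0"
  shows "X \<in> focal_conic D w \<rho> \<longleftrightarrow> focal_form D w \<rho> (hom_coords X) (hom_coords X) = 0"
proof -
  have "\<rho> * dist X D = \<bar>w \<bullet> (X - D) - 1\<bar> \<longleftrightarrow> (\<rho> * dist X D)\<^sup>2 = (w \<bullet> (X - D) - 1)\<^sup>2"
    using assms power2_eq_iff_nonneg[of "\<rho> * dist X D" "\<bar>w \<bullet> (X - D) - 1\<bar>"] by simp
  moreover have "(\<rho> * dist X D)\<^sup>2 = \<rho>\<^sup>2 * ((X - D) \<bullet> (X - D))"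
    by (simp add: power_mult_distrib dist_norm power2_norm_eq_inner)
  ultimately show ?thesis
    by (simp only: focal_conic_def focal_form_def hom_coords_focal mem_Collect_eq
        power2_eq_square[of "w \<bullet> (X - D) - 1", symmetric] right_minus_eq)
qed

lemma bilinear_form_expand:
  fixes M :: "real^3^3"
  shows "P \<bullet> (M *v Q) = (\<Sum>i\<in>UNIV. \<Sum>j\<in>UNIV. P $ i * M $ i $ j * Q $ j)"
  by (simp add: inner_vec_def matrix_vector_mult_def sum_distrib_left mult.assoc)

definition focal_matrix :: "plane \<Rightarrow> plane \<Rightarrow> real \<Rightarrow> real^3^3" where
  "focal_matrix D w \<rho> = (\<chi> i j. focal_form D w \<rho> (axis i 1) (axis j 1))"

lemma conic_matrix_focal_matrix:
  assumes "\<rho> > 0"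
  shows "conic_matrix (focal_matrix D w \<rho>) (focal_conic D w \<rho>)"
    and "P \<bullet> (focal_matrix D w \<rho> *v Q) = focal_form D w \<rho> P Q"
proof -
  show *: "P \<bullet> (focal_matrix D w \<rho> *v Q) = focal_form D w \<rho> P Q" for P Q
    unfolding bilinear_form_expand focal_matrix_def focal_form_def polar_form_def inner_plane sum_3
    by (simp add: axis_def) algebra
  have "transpose (focal_matrix D w \<rho>) = focal_matrix D w \<rho>"
    by (simp add: transpose_def focal_matrix_def focal_form_def inner_commute mult.commute)
  moreover have "det (focal_matrix D w \<rho>) = - (\<rho> ^ 4)"
    unfolding det_3 focal_matrix_def focal_form_def polar_form_def inner_plane
    by (simp add: axis_def) algebra
  ultimately show "conic_matrix (focal_matrix D w \<rho>) (focal_conic D w \<rho>)"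
    unfolding conic_matrix_def * using assms mem_focal_conic_iff[OF assms] by auto
qed

lemma is_conic_focal_conic:
  assumes "\<rho> > 0"
  shows "is_conic (focal_conic D w \<rho>)"
proof -
  define v :: plane where "v = (if w = 0 then axis 1 1 else (1 / norm w) *\<^sub>R w)"
  have v: "norm v = 1" "w \<bullet> v \<ge> 0" by (auto simp: v_def norm_axis_1)
  define X where "X = D + (1 / (\<rho> + w \<bullet> v)) *\<^sub>R v"
  have "X \<in> focal_conic D w \<rho>"
    using v assms by (simp add: focal_conic_def X_def dist_norm field_simps)
  then show ?thesis
    using conic_matrix_focal_matrix(1)[OF assms] unfolding is_conic_def by blast
qed

text \<open>The set of affine points determines the form of the conic up to a factor. In focal
  coordinates the cone is parametrised rationally by
  \<open>(1 - \<tau>\<^sup>2, 2 * \<tau>, - \<rho> * (1 + \<tau>\<^sup>2))\<close>, so a form vanishing on the conic pulls back to a polynomial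
  of degree at most four in \<open>\<tau>\<close>. It vanishes except perhaps where the parametrised point lies at
  infinity, hence identically, and its five coefficients force the form to be proportional to the
  cone.\<close>

lemma conic_matrix_unique:
  assumes "\<rho> > 0" "conic_matrix M (focal_conic D w \<rho>)"
  obtains c where "c \<noteq> 0" "\<And>P Q. P \<bullet> (M *v Q) = c * focal_form D w \<rho> P Q"
proof -
  define B where "B P Q = P \<bullet> (M *v Q)" for P Q :: "real^3"
  have M: "transpose M = M" "det M \<noteq> 0"
    and K: "\<And>X. X \<in> focal_conic D w \<rho> \<longleftrightarrow> B (hom_coords X) (hom_coords X) = 0"
    using assms(2) by (auto simp: conic_matrix_def B_def)
  have sym: "B P Q = B Q P" for P Q
    by (metis B_def M(1) dot_lmul_matrix inner_commute transpose_matrix_vector)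
  have lin: "B (P + P') Q = B P Q + B P' Q" "B Q (P + P') = B Q P + B Q P'"
    "B (a *\<^sub>R P) Q = a * B P Q" "B Q (a *\<^sub>R P) = a * B Q P" for P P' Q a
    by (simp_all add: B_def inner_add_left inner_add_right matrix_vector_right_distrib
        matrix_vector_mult_scaleR)
  define E where "E = (\<lambda>y s. of_focal_coords D w (vector y) s)"
  define E1 E2 E3 where "E1 = E [1, 0] 0" and "E2 = E [0, 1] 0" and "E3 = E [0, 0] 1"
  define a b c d e f where "a = B E1 E1" and "b = B E1 E2" and "c = B E2 E2"
    and "d = B E1 E3" and "e = B E2 E3" and "f = B E3 E3"
  have coords: "of_focal_coords D w y s = (y $ 1) *\<^sub>R E1 + (y $ 2) *\<^sub>R E2 + s *\<^sub>R E3" for y s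
    by (rule vec3_eqI)
       (simp_all add: E1_def E2_def E3_def E_def of_focal_coords_def Let_def inner_plane algebra_simps)
  have expand: "B (of_focal_coords D w y s) (of_focal_coords D w z t) =
      a * y $ 1 * z $ 1 + b * (y $ 1 * z $ 2 + y $ 2 * z $ 1) + c * y $ 2 * z $ 2
      + d * (y $ 1 * t + s * z $ 1) + e * (y $ 2 * t + s * z $ 2) + f * s * t" for y s z t
    unfolding coords lin sym[of E2 E1] sym[of E3 E1] sym[of E3 E2]
    by (simp add: a_def b_def c_def d_def e_def f_def algebra_simps)
  \<comment> \<open>\<open>p\<close> is the pulled back form, and \<open>q\<close> vanishes where the parametrised point is at infinity.\<close>
  define p where "p = [: a + f * \<rho>\<^sup>2 - 2 * d * \<rho>, 4 * b - 4 * e * \<rho>,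
      2 * f * \<rho>\<^sup>2 + 4 * c - 2 * a, - 4 * b - 4 * e * \<rho>, a + f * \<rho>\<^sup>2 + 2 * d * \<rho> :]"
  define q where "q = [: \<rho> + w $ 1, 2 * w $ 2, \<rho> - w $ 1 :]"
  have "poly p \<tau> = 0 \<or> poly q \<tau> = 0" for \<tau>
  proof (cases "poly q \<tau> = 0")
    case False
    define y :: plane where "y = vector [1 - \<tau>\<^sup>2, 2 * \<tau>]"
    define s where "s = - \<rho> * (1 + \<tau>\<^sup>2)"
    define t where "t = w \<bullet> y - s"
    define P where "P = of_focal_coords D w y s"
    have "t = poly q \<tau>"
      by (simp add: t_def q_def y_def s_def inner_plane power2_eq_square algebra_simps)
    then have t: "t \<noteq> 0" using False by simp
    define X where "X = D + (1 / t) *\<^sub>R y"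
    have P: "P = t *\<^sub>R hom_coords X"
      using t by (intro vec3_eqI)
        (simp_all add: P_def of_focal_coords_def X_def t_def[symmetric] Let_def algebra_simps)
    have "focal_form D w \<rho> P P = 0"
      by (simp add: P_def focal_form_def, simp add: inner_plane y_def s_def) algebra
    then have "t\<^sup>2 * focal_form D w \<rho> (hom_coords X) (hom_coords X) = 0"
      unfolding P conic_matrix_focal_matrix(2)[OF assms(1), symmetric]
      by (simp add: matrix_vector_mult_scaleR power2_eq_square)
    then have "X \<in> focal_conic D w \<rho>" using t mem_focal_conic_iff[OF assms(1)] by simp
    then have "B P P = 0" unfolding P lin using K by simp
    moreover have "B P P = poly p \<tau>"
      unfolding P_def expand p_def by (simp add: y_def s_def) algebra
    ultimately show ?thesis by simp
  qed simp
  then have "poly (p * q) \<tau> = 0" for \<tau> by simp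
  then have "p * q = 0" using poly_all_0_iff_0 by blast
  moreover have "q \<noteq> 0" using assms(1) by (auto simp: q_def)
  ultimately have "p = 0" by simp
  then have p: "a + f * \<rho>\<^sup>2 - 2 * d * \<rho> = 0" "4 * b - 4 * e * \<rho> = 0"
      "2 * f * \<rho>\<^sup>2 + 4 * c - 2 * a = 0" "- 4 * b - 4 * e * \<rho> = 0" "a + f * \<rho>\<^sup>2 + 2 * d * \<rho> = 0"
    unfolding p_def by (simp_all only: pCons_eq_0_iff)
  have "d * \<rho> = 0" "e * \<rho> = 0" using p by linarith+
  then have de: "d = 0" "e = 0" using assms(1) by simp_all
  then have b: "b = 0" and f: "a = - f * \<rho>\<^sup>2" and c: "c = - f * \<rho>\<^sup>2" using p by simp_all
  have form: "B P Q = - f * focal_form D w \<rho> P Q" for P Q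
  proof -
    have "B P Q = B (of_focal_coords D w (affine_part D P) (polar_form D w P))
        (of_focal_coords D w (affine_part D Q) (polar_form D w Q))" by simp
    also have "\<dots> = - f * focal_form D w \<rho> P Q"
      unfolding expand de b f c focal_form_def inner_plane by (simp add: algebra_simps)
    finally show ?thesis .
  qed
  have "f \<noteq> 0"
  proof
    assume "f = 0"
    then have "P \<bullet> (M *v Q) = 0" for P Q using form by (simp add: B_def)
    then have "M *v Q = 0" for Q by (metis inner_eq_zero_iff)
    then have "M = 0" by (metis matrix_vector_mult_0 matrix_eq)
    then show False using M(2) by (simp add: det_3)
  qed
  then show thesis using that[of "- f"] form by (simp add: B_def)
qed

text \<open>The polar dual of a conic about its focus is a circle. If a point of the cone has focal
  coordinates \<open>y\<close> and \<open>s\<close>, then the gradient of the form there is proportional to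
  \<open>X \<mapsto> u \<bullet> (X - D) - 1\<close> with \<open>u = w - (\<rho>\<^sup>2 / s) *\<^sub>R y\<close>, and the equation of the cone says exactly
  that \<open>u\<close> has distance \<open>\<rho>\<close> from \<open>w\<close>. Points at infinity need no separate treatment, so asymptotes
  are included; \<open>u = 0\<close> would be the line at infinity, which touches a parabola.\<close>

lemma tangent_to_focal_conic:
  assumes "\<rho> > 0"
  shows "tangent_to l (focal_conic D w \<rho>) \<longleftrightarrow>
           (\<exists>u. u \<noteq> 0 \<and> norm (u - w) = \<rho> \<and> l = polar_line D u)"
proof
  assume "tangent_to l (focal_conic D w \<rho>)"
  then obtain M P where l: "is_line l" "l = {X. hom_coords X \<bullet> (M *v P) = 0}"
    and M: "conic_matrix M (focal_conic D w \<rho>)" and P: "P \<noteq> 0" "P \<bullet> (M *v P) = 0"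
    unfolding tangent_to_def by blast
  obtain c where c: "c \<noteq> 0" "\<And>P Q. P \<bullet> (M *v Q) = c * focal_form D w \<rho> P Q"
    using conic_matrix_unique[OF assms M] by blast
  define y s where "y = affine_part D P" and "s = polar_form D w P"
  have q: "\<rho>\<^sup>2 * (y \<bullet> y) = s\<^sup>2"
    using P(2) c by (simp add: focal_form_def y_def s_def power2_eq_square)
  have s: "s \<noteq> 0"
  proof
    assume "s = 0"
    then have "y = 0" using q assms by simp
    then have "P = of_focal_coords D w 0 0" using \<open>s = 0\<close> focal_coords_inverse(3)[of D w P]
      by (simp add: y_def s_def)
    also have "\<dots> = 0" by (rule vec3_eqI) (simp_all add: of_focal_coords_def)
    finally show False using P(1) by simp
  qed
  define u where "u = w - (\<rho>\<^sup>2 / s) *\<^sub>R y"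
  have su: "s * (w \<bullet> x) - s * (u \<bullet> x) = \<rho>\<^sup>2 * (y \<bullet> x)" for x
    using s by (simp add: u_def inner_diff_left field_simps)
  have "hom_coords X \<bullet> (M *v P) = 0 \<longleftrightarrow> u \<bullet> (X - D) = 1" for X
  proof -
    have "hom_coords X \<bullet> (M *v P) = - c * s * (u \<bullet> (X - D) - 1)"
      unfolding c(2) focal_form_def hom_coords_focal y_def[symmetric] s_def[symmetric]
      using su[of "X - D"] inner_commute[of y "X - D"] by algebra
    then show ?thesis using c s by simp
  qed
  then have lu: "l = polar_line D u" by (simp add: l(2) polar_line_def)
  have "(norm (u - w))\<^sup>2 = \<rho>\<^sup>2"
    unfolding power2_norm_eq_inner using q s
    by (simp add: u_def power2_eq_square field_simps)
  then have "norm (u - w) = \<rho>" using assms by (simp add: power2_eq_iff_nonneg)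
  moreover have "u \<noteq> 0"
  proof
    assume "u = 0"
    then have "l = {}" by (simp add: lu polar_line_def)
    then show False using l(1) by (auto simp: is_line_def)
  qed
  ultimately show "\<exists>u. u \<noteq> 0 \<and> norm (u - w) = \<rho> \<and> l = polar_line D u" using lu by blast
next
  assume "\<exists>u. u \<noteq> 0 \<and> norm (u - w) = \<rho> \<and> l = polar_line D u"
  then obtain u where u: "u \<noteq> 0" "norm (u - w) = \<rho>" "l = polar_line D u" by blast
  \<comment> \<open>The point of contact, scaled so that its coordinate \<open>s\<close> is \<open>\<rho>\<^sup>2\<close>.\<close>
  define P where "P = of_focal_coords D w (w - u) (\<rho>\<^sup>2)"
  have "(u - w) \<bullet> (u - w) = \<rho>\<^sup>2" using u(2) by (simp flip: power2_norm_eq_inner)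
  then have "focal_form D w \<rho> P P = 0"
    by (simp add: P_def focal_form_def inner_diff inner_commute power2_eq_square algebra_simps)
  moreover have "P \<noteq> 0"
  proof
    assume "P = 0"
    then have "polar_form D w P = 0" by (simp add: polar_form_def inner_plane)
    then show False using assms by (simp add: P_def)
  qed
  moreover have "l = {X. focal_form D w \<rho> (hom_coords X) P = 0}"
  proof -
    have "focal_form D w \<rho> (hom_coords X) P = - \<rho>\<^sup>2 * (u \<bullet> (X - D) - 1)" for X
      by (simp add: P_def focal_form_def inner_diff inner_commute algebra_simps)
    then show ?thesis using assms by (simp add: u(3) polar_line_def)
  qed
  moreover have "is_line l" using is_line_polar_line[OF u(1)] u(3) by simp
  ultimately show "tangent_to l (focal_conic D w \<rho>)"
    unfolding tangent_to_def conic_matrix_focal_matrix(2)[OF assms, symmetric]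
    using conic_matrix_focal_matrix(1)[OF assms]
    by (intro conjI exI[of _ "focal_matrix D w \<rho>"] exI[of _ P]) simp_all
qed

text \<open>The equation of a circle in coordinates with origin \<open>D\<close>; its constant term is the power
  of \<open>D\<close>.\<close>

lemma mem_sphere_iff_power:
  fixes E D :: plane
  assumes "r > 0"
  shows "X \<in> sphere E r \<longleftrightarrow>
    (X - D) \<bullet> (X - D) - 2 * ((E - D) \<bullet> (X - D)) + ((E - D) \<bullet> (E - D) - r\<^sup>2) = 0"
proof -
  have "X \<in> sphere E r \<longleftrightarrow> (norm ((X - D) - (E - D)))\<^sup>2 = r\<^sup>2"
    using assms by (simp add: dist_norm norm_minus_commute power2_eq_iff_nonneg)
  then show ?thesis unfolding power2_norm_eq_inner
    by (simp add: inner_diff_left[of "X - D"] inner_diff_right[of _ "X - D"]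
        inner_diff_left[of "E - D"] inner_commute algebra_simps)
qed

text \<open>The conic with focus \<open>D\<close> whose tangents have the feet of their perpendiculars from \<open>D\<close> on the
  given circle. Its polar dual is the inverse of that circle about \<open>D\<close>; \<open>\<kappa>\<close> is the power of \<open>D\<close>.\<close>

definition pedal_conic :: "plane \<Rightarrow> plane \<Rightarrow> real \<Rightarrow> plane set" where
  "pedal_conic D E r = (let \<kappa> = (E - D) \<bullet> (E - D) - r\<^sup>2 in
     focal_conic D ((1 / \<kappa>) *\<^sub>R (E - D)) (r / \<bar>\<kappa>\<bar>))"

lemma power_of_point_ne_0:
  fixes E D :: plane
  assumes "r > 0" "D \<notin> sphere E r"
  shows "(E - D) \<bullet> (E - D) - r\<^sup>2 \<noteq> 0"
  using mem_sphere_iff_power[OF assms(1), of D E D] assms(2) by simp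

text \<open>A line is tangent exactly if its dual point lies on the polar dual circle, that is, if the
  inverse of that point, which is the foot, lies on the inverse circle. Lines through \<open>D\<close> have
  foot \<open>D\<close> and satisfy neither side.\<close>

lemma tangent_to_pedal_conic_iff:
  assumes r: "r > 0" and D: "D \<notin> sphere E r" and l: "is_line l"
  shows "tangent_to l (pedal_conic D E r) \<longleftrightarrow> foot D l \<in> sphere E r"
proof -
  define k \<kappa> where "k = E - D" and "\<kappa> = k \<bullet> k - r\<^sup>2"
  note sphere = mem_sphere_iff_power[OF r, of _ E D, folded k_def, folded \<kappa>_def]
  have \<kappa>: "\<kappa> \<noteq> 0" using power_of_point_ne_0[OF r D] by (simp add: \<kappa>_def k_def)
  have \<rho>: "r / \<bar>\<kappa>\<bar> > 0" using r \<kappa> by simp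
  show ?thesis
    unfolding pedal_conic_def Let_def k_def[symmetric] \<kappa>_def[symmetric] tangent_to_focal_conic[OF \<rho>]
  proof (cases "D \<in> l")
    case True
    then show "(\<exists>u. u \<noteq> 0 \<and> norm (u - (1 / \<kappa>) *\<^sub>R k) = r / \<bar>\<kappa>\<bar> \<and> l = polar_line D u) \<longleftrightarrow>
        foot D l \<in> sphere E r"
      using D foot_of_mem[OF l True] by (auto simp: polar_line_def)
  next
    case False
    obtain u where u: "u \<noteq> 0" "l = polar_line D u" using line_avoiding_point[OF l False] .
    define q where "q = u \<bullet> u"
    have q: "q \<noteq> 0" using u by (simp add: q_def)
    have "foot D l \<in> sphere E r \<longleftrightarrow> 1 / q - 2 * (k \<bullet> u) / q + \<kappa> = 0"
      unfolding sphere u(2) foot_polar_line[OF u(1)] q_def[symmetric]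
      using q by (simp flip: q_def)
    also have "\<dots> \<longleftrightarrow> \<kappa> * q - 2 * (k \<bullet> u) + 1 = 0"
      using q by (auto simp: field_simps)
    also have "\<dots> \<longleftrightarrow> (norm (u - (1 / \<kappa>) *\<^sub>R k))\<^sup>2 = (r / \<bar>\<kappa>\<bar>)\<^sup>2"
    proof -
      have "\<kappa>\<^sup>2 * ((norm (u - (1 / \<kappa>) *\<^sub>R k))\<^sup>2 - (r / \<bar>\<kappa>\<bar>)\<^sup>2) = \<kappa>\<^sup>2 * q - 2 * \<kappa> * (k \<bullet> u) + k \<bullet> k - r\<^sup>2"
        using \<kappa> unfolding power2_norm_eq_inner
        by (simp add: inner_diff inner_commute q_def power2_eq_square field_simps)
      also have "\<dots> = \<kappa> * (\<kappa> * q - 2 * (k \<bullet> u) + 1)"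
        by (simp add: \<kappa>_def algebra_simps power2_eq_square)
      finally show ?thesis using \<kappa> by auto
    qed
    also have "\<dots> \<longleftrightarrow> norm (u - (1 / \<kappa>) *\<^sub>R k) = r / \<bar>\<kappa>\<bar>"
      by (rule power2_eq_iff_nonneg[OF norm_ge_zero less_imp_le[OF \<rho>]])
    finally show "(\<exists>u. u \<noteq> 0 \<and> norm (u - (1 / \<kappa>) *\<^sub>R k) = r / \<bar>\<kappa>\<bar> \<and> l = polar_line D u) \<longleftrightarrow>
        foot D l \<in> sphere E r"
      using u polar_line_inj by blast
  qed
qed

text \<open>Tangency of \<open>l\<close> to \<open>focal_conic D w \<rho>\<close> is an affine condition on the foot of \<open>l\<close> once the
  foot is known to lie on a fixed circle. As it holds at three non-collinear feet, it determines
  \<open>w\<close> and \<open>\<rho>\<close>.\<close>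

lemma tangent_lines_determine_focal_conic:
  assumes r: "r > 0" and \<rho>: "\<rho> > 0" "\<rho>' > 0"
    and t: "\<And>l. l \<in> {l1, l2, l3} \<Longrightarrow> tangent_to l (focal_conic D w \<rho>)"
           "\<And>l. l \<in> {l1, l2, l3} \<Longrightarrow> tangent_to l (focal_conic D w' \<rho>')"
    and nc: "\<not> collinear {foot D l1, foot D l2, foot D l3}"
    and E: "foot D l1 \<in> sphere E r" "foot D l2 \<in> sphere E r" "foot D l3 \<in> sphere E r"
  shows "focal_conic D w \<rho> = focal_conic D w' \<rho>'"
proof -
  have eq: "1 - 2 * (w \<bullet> (foot D l - D)) + (w \<bullet> w - \<rho>\<^sup>2) * ((foot D l - D) \<bullet> (foot D l - D)) = 0"
    if l: "tangent_to l (focal_conic D w \<rho>)" and \<rho>: "\<rho> > 0" for l w \<rho>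
  proof -
    obtain u where u: "u \<noteq> 0" "norm (u - w) = \<rho>" "l = polar_line D u"
      using l unfolding tangent_to_focal_conic[OF \<rho>] by blast
    define q where "q = u \<bullet> u"
    have q: "q \<noteq> 0" using u by (simp add: q_def)
    have "q - 2 * (w \<bullet> u) + w \<bullet> w = \<rho>\<^sup>2"
      unfolding u(2)[symmetric] power2_norm_eq_inner q_def by (simp add: inner_diff inner_commute)
    then have m: "w \<bullet> w - \<rho>\<^sup>2 = 2 * (w \<bullet> u) - q" by simp
    show ?thesis using q
      unfolding u(3) foot_polar_line[OF u(1)] m by (simp add: q_def[symmetric] field_simps)
  qed
  define k \<kappa> where "k = E - D" and "\<kappa> = k \<bullet> k - r\<^sup>2"
  note sphere = mem_sphere_iff_power[OF r, of _ E D, folded k_def, folded \<kappa>_def, THEN iffD1]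
  have det: "w = (w \<bullet> w - \<rho>\<^sup>2) *\<^sub>R k \<and> (w \<bullet> w - \<rho>\<^sup>2) * \<kappa> = 1"
    if tang: "\<And>l. l \<in> {l1, l2, l3} \<Longrightarrow> tangent_to l (focal_conic D w \<rho>)" and \<rho>: "\<rho> > 0" for w \<rho>
  proof -
    define m where "m = w \<bullet> w - \<rho>\<^sup>2"
    define n where "n = 2 *\<^sub>R (w - m *\<^sub>R k)"
    have n: "n \<bullet> (X - D) = 1 - m * \<kappa>" if X: "X \<in> {foot D l1, foot D l2, foot D l3}" for X
    proof -
      have 1: "1 - 2 * (w \<bullet> (X - D)) + m * ((X - D) \<bullet> (X - D)) = 0"
        using eq[OF tang \<rho>] X unfolding m_def by blast
      have 2: "(X - D) \<bullet> (X - D) - 2 * (k \<bullet> (X - D)) + \<kappa> = 0"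
        using sphere X E by blast
      have "n \<bullet> (X - D) = 2 * (w \<bullet> (X - D)) - 2 * m * (k \<bullet> (X - D))"
        unfolding n_def inner_scaleR_left inner_diff_left[of w] by simp
      then show ?thesis using 1 2 by algebra
    qed
    have "n = 0"
      by (rule noncollinear_inner_eq[OF nc])
        (use n[of "foot D l1"] n[of "foot D l2"] n[of "foot D l3"] in \<open>simp_all add: inner_diff_right\<close>)
    then have "w = m *\<^sub>R k" "m * \<kappa> = 1" using n[of "foot D l1"] by (simp_all add: n_def)
    then show ?thesis by (simp add: m_def)
  qed
  define m m' where "m = w \<bullet> w - \<rho>\<^sup>2" and "m' = w' \<bullet> w' - \<rho>'\<^sup>2"
  have "w = m *\<^sub>R k" "m * \<kappa> = 1" "w' = m' *\<^sub>R k" "m' * \<kappa> = 1"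
    using det[OF t(1) \<rho>(1)] det[OF t(2) \<rho>(2)] by (auto simp: m_def m'_def)
  moreover from this have "m = m'" by (metis mult_cancel_right mult_zero_right zero_neq_one)
  ultimately have w: "w = w'" by simp
  then have "\<rho>\<^sup>2 = \<rho>'\<^sup>2" using \<open>m = m'\<close> by (simp add: m_def m'_def)
  then show ?thesis using w \<rho> by (simp add: power2_eq_iff_nonneg)
qed

section \<open>Chords of the unit circle and isogonal conjugates\<close>

text \<open>The complex coordinate in which the circle with centre \<open>Z\<close> and radius \<open>R\<close> is the unit circle.
  Conjugation acts on its points as inversion \<open>cnj a = 1 / a\<close>, so that all conditions on inscribed
  triangles become polynomial identities.\<close>

definition chart :: "plane \<Rightarrow> real \<Rightarrow> complex \<Rightarrow> plane" where
  "chart Z R z = vector [Z $ 1 + R * Re z, Z $ 2 + R * Im z]"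

lemma chart_nth [simp]:
  "chart Z R z $ 1 = Z $ 1 + R * Re z" "chart Z R z $ 2 = Z $ 2 + R * Im z"
  by (simp_all add: chart_def)

lemma chart_surj:
  assumes "R > 0"
  obtains z where "X = chart Z R z"
proof
  show "X = chart Z R (Complex ((X $ 1 - Z $ 1) / R) ((X $ 2 - Z $ 2) / R))"
    using assms by (intro plane_eqI) simp_all
qed

lemma inner_chart:
  "(chart Z R x - chart Z R y) \<bullet> (chart Z R z - chart Z R t) = R\<^sup>2 * Re ((x - y) * cnj (z - t))"
  "perp (chart Z R x - chart Z R y) \<bullet> (chart Z R z - chart Z R t) = R\<^sup>2 * Im (cnj (x - y) * (z - t))"
  by (simp_all add: inner_plane) algebra+

lemma dist_chart:
  assumes "R > 0"
  shows "dist (chart Z R x) (chart Z R y) = R * cmod (x - y)"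
proof -
  have "(dist (chart Z R x) (chart Z R y))\<^sup>2 = R\<^sup>2 * Re ((x - y) * cnj (x - y))"
    unfolding dist_norm power2_norm_eq_inner inner_chart ..
  also have "\<dots> = (R * cmod (x - y))\<^sup>2"
    unfolding complex_norm_square[symmetric] by (simp add: power_mult_distrib)
  finally have "(dist (chart Z R x) (chart Z R y))\<^sup>2 = (R * cmod (x - y))\<^sup>2" .
  then show ?thesis using assms by (simp add: power2_eq_iff_nonneg)
qed

lemma chart_mem_sphere_iff:
  assumes "R > 0"
  shows "chart Z R z \<in> sphere (chart Z R e) (R * s) \<longleftrightarrow> cmod (z - e) = s"
    and "chart Z R z \<in> sphere Z R \<longleftrightarrow> cmod z = 1"
proof -
  show *: "chart Z R z \<in> sphere (chart Z R e) (R * s) \<longleftrightarrow> cmod (z - e) = s" for e s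
    using assms by (simp add: dist_chart norm_minus_commute)
  have "chart Z R 0 = Z" by (rule plane_eqI) simp_all
  then show "chart Z R z \<in> sphere Z R \<longleftrightarrow> cmod z = 1" using *[of 0 1] by simp
qed

lemma chart_eq_iff: "R > 0 \<Longrightarrow> chart Z R x = chart Z R y \<longleftrightarrow> x = y"
  by (metis dist_chart dist_eq_0_iff mult_eq_0_iff less_irrefl norm_eq_zero right_minus_eq)

definition chord_foot :: "complex \<Rightarrow> complex \<Rightarrow> complex \<Rightarrow> complex" where
  "chord_foot d a b = (a + b + d - a * b * cnj d) / 2"

lemma foot_chord:
  assumes R: "R > 0" and ab: "cmod a = 1" "cmod b = 1" "a \<noteq> b"
  shows "foot (chart Z R d) (line_through (chart Z R a) (chart Z R b)) = chart Z R (chord_foot d a b)"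
    and "chart Z R (chord_foot d a b) \<in> line_through (chart Z R a) (chart Z R b)"
proof -
  define f where "f = chord_foot d a b"
  have ne: "chart Z R a \<noteq> chart Z R b" using R ab(3) by (simp add: chart_eq_iff)
  have ab': "(Re a)\<^sup>2 + (Im a)\<^sup>2 = 1" "(Re b)\<^sup>2 + (Im b)\<^sup>2 = 1"
    using ab(1,2) by (metis cmod_power2 one_power2)+
  have f: "2 * Re f = Re (a + b + d - a * b * cnj d)" "2 * Im f = Im (a + b + d - a * b * cnj d)"
    by (simp_all add: f_def chord_foot_def)
  have "Im (cnj (b - a) * (f - a)) = 0" "Re ((d - f) * cnj (b - a)) = 0"
    using ab' f by (simp_all, algebra+)
  then show mem: "chart Z R (chord_foot d a b) \<in> line_through (chart Z R a) (chart Z R b)"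
    and "foot (chart Z R d) (line_through (chart Z R a) (chart Z R b)) = chart Z R (chord_foot d a b)"
    using ne by (auto simp: line_through_eq inner_chart f_def[symmetric] intro!: foot_eqI)
qed

text \<open>With \<open>d\<close> and \<open>d'\<close> as foci, the two factors of the first product are, up to unimodular factors,
  twice the signed distances of the foci from the chord through \<open>a\<close> and \<open>b\<close>. Vanishing of the form
  thus says that this product of distances has the value
  \<open>(1 - \<bar>d\<bar>\<^sup>2) * (1 - \<bar>d'\<bar>\<^sup>2) / 4\<close>, which does not depend on the chord: the classical tangency
  condition for a central conic.\<close>

definition chord_form :: "complex \<Rightarrow> complex \<Rightarrow> complex \<Rightarrow> complex \<Rightarrow> complex" where
  "chord_form d d' a b = (a + b - d - cnj d * a * b) * (a + b - d' - cnj d' * a * b)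
     - (1 - d * cnj d) * (1 - d' * cnj d') * a * b"

text \<open>The relation between isogonal conjugates \<open>d\<close> and \<open>d'\<close> with respect to a triangle inscribed in the
  unit circle. The triangle enters only through its symmetric functions \<open>a + b + c\<close> and \<open>a * b * c\<close>.\<close>

definition conjugate_points :: "complex \<Rightarrow> complex \<Rightarrow> complex \<Rightarrow> complex \<Rightarrow> complex \<Rightarrow> bool" where
  "conjugate_points d d' a b c \<longleftrightarrow> a + b + c - a * b * c * cnj d * cnj d' = d + d'"

lemma cmod_eq_1_iff: "cmod z = 1 \<longleftrightarrow> z * cnj z = 1"
  by (metis complex_norm_square norm_ge_zero of_real_1 of_real_eq_iff power2_eq_1_iff
      one_power2 power2_eq_iff_nonneg zero_le_one)

lemma cmod_eq_iff: "cmod x = cmod y \<longleftrightarrow> x * cnj x = y * cnj y"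
  by (metis complex_norm_square norm_ge_zero of_real_eq_iff power2_eq_iff_nonneg)

text \<open>The pedal circle of two isogonal conjugates is centred at their midpoint. After
  multiplication by \<open>a * b\<close> the difference of the two squared norms becomes \<open>chord_form\<close>; the radius
  is explained by
  \<open>\<bar>d - d'\<bar>\<^sup>2 + (1 - \<bar>d\<bar>\<^sup>2) * (1 - \<bar>d'\<bar>\<^sup>2) = \<bar>1 - cnj d * d'\<bar>\<^sup>2\<close>.\<close>

lemma chord_foot_on_pedal_circle_iff:
  assumes "cmod a = 1" "cmod b = 1"
  shows "cmod (chord_foot d a b - (d + d') / 2) = cmod ((1 - cnj d * d') / 2) \<longleftrightarrow> chord_form d d' a b = 0"
proof -
  have ab: "a * cnj a = 1" "b * cnj b = 1" using assms by (simp_all flip: cmod_eq_1_iff)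
  then have nz: "a \<noteq> 0" "b \<noteq> 0" by auto
  define x y where "x = a + b - a * b * cnj d - d'" and "y = 1 - cnj d * d'"
  have x: "chord_foot d a b - (d + d') / 2 = x / 2"
    by (simp add: chord_foot_def x_def field_simps)
  have "cmod (x / 2) = cmod (y / 2) \<longleftrightarrow> x * cnj x - y * cnj y = 0"
    by (simp add: norm_divide cmod_eq_iff)
  also have "\<dots> \<longleftrightarrow> a * b * (x * cnj x - y * cnj y) = 0" using nz by simp
  also have "a * b * (x * cnj x - y * cnj y) = chord_form d d' a b"
    unfolding x_def y_def chord_form_def using ab by simp algebra
  finally show ?thesis unfolding x y_def .
qed

text \<open>The relation and its complex conjugate are two linear equations for \<open>d'\<close> and \<open>cnj d'\<close>, with
  determinant \<open>1 - d * cnj d\<close>.\<close>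

lemma conjugate_point_exists:
  assumes "cmod a = 1" "cmod b = 1" "cmod c = 1" "cmod d \<noteq> 1"
  obtains d' where "conjugate_points d d' a b c"
proof -
  have abc: "a * cnj a = 1" "b * cnj b = 1" "c * cnj c = 1"
    using assms by (simp_all flip: cmod_eq_1_iff)
  define t where "t = 1 - d * cnj d"
  have t: "t \<noteq> 0" "cnj t = t" using assms(4) by (auto simp: t_def cmod_eq_1_iff)
  define n where "n = a + b + c - d - (a * b + b * c + c * a) * cnj d + a * b * c * cnj d ^ 2"
  have "t * (a + b + c) - a * b * c * cnj d * cnj n = t * d + n"
    unfolding n_def t_def using abc by simp algebra
  then have "a + b + c - a * b * c * cnj d * cnj (n / t) = d + n / t"
    using t by (simp add: field_simps)
  then show thesis using that[of "n / t"] by (simp add: conjugate_points_def)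
qed

text \<open>Eliminating \<open>c\<close> between the relation and its conjugate by means of \<open>c * cnj c = 1\<close> leaves
  \<open>chord_form\<close>.\<close>

lemma conjugate_points_chord_form:
  assumes "cmod a = 1" "cmod b = 1" "cmod c = 1" "conjugate_points d d' a b c"
  shows "chord_form d d' a b = 0"
proof -
  have abc: "a * cnj a = 1" "b * cnj b = 1" "c * cnj c = 1"
    using assms by (simp_all flip: cmod_eq_1_iff)
  have 1: "a + b + c - a * b * c * cnj d * cnj d' = d + d'"
    using assms(4) by (simp add: conjugate_points_def)
  then have "cnj (a + b + c - a * b * c * cnj d * cnj d') = cnj (d + d')" by simp
  then have 2: "cnj a + cnj b + cnj c - cnj a * cnj b * cnj c * d * d' = cnj d + cnj d'" by simp
  have c1: "c * (1 - a * b * cnj d * cnj d') = d + d' - a - b" using 1 by algebra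
  have c2: "cnj c * (a * b - d * d') = a * b * (cnj d + cnj d') - a - b" using 2 abc by algebra
  have "(1 - a * b * cnj d * cnj d') * (a * b - d * d')
      = (d + d' - a - b) * (a * b * (cnj d + cnj d') - a - b)"
    unfolding c1[symmetric] c2[symmetric] using abc(3) by algebra
  then show ?thesis unfolding chord_form_def by algebra
qed

text \<open>The algebraic core of the porism. For fixed \<open>a\<close> the form is quadratic in the other endpoint,
  so two distinct zeros \<open>b\<close> and \<open>c\<close> satisfy Vieta's formulas; these give precisely the relation of
  isogonal conjugacy, which is symmetric in \<open>a\<close>, \<open>b\<close>, \<open>c\<close>. The leading coefficient vanishes only if
  \<open>d\<close> or \<open>d'\<close> is the point \<open>a\<close>.\<close>

lemma chord_form_porism:
  assumes "cmod a = 1" "cmod d \<noteq> 1" "cmod d' \<noteq> 1" "b \<noteq> c"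
    and "chord_form d d' a b = 0" "chord_form d d' a c = 0"
  shows "conjugate_points d d' a b c"
proof -
  have nz: "1 - cnj x * a \<noteq> 0" if "cmod x \<noteq> 1" for x
  proof
    assume "1 - cnj x * a = 0"
    then have "cmod (cnj x * a) = 1" by (metis eq_iff_diff_eq_0 norm_one)
    then show False using that assms(1) by (simp add: norm_mult)
  qed
  define q2 q1 q0 where "q2 = (1 - cnj d * a) * (1 - cnj d' * a)"
    and "q1 = (a - d) * (1 - cnj d' * a) + (a - d') * (1 - cnj d * a)
      - (1 - d * cnj d) * (1 - d' * cnj d') * a"
    and "q0 = (a - d) * (a - d')"
  have form: "chord_form d d' a x = q2 * x\<^sup>2 + q1 * x + q0" for x
    unfolding chord_form_def q2_def q1_def q0_def by algebra
  have "(b - c) * (q2 * (b + c) + q1) = 0" "(b - c) * (q2 * (b * c) - q0) = 0"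
    using assms(5,6) unfolding form by algebra+
  then have vieta: "q2 * (b + c) = - q1" "q2 * (b * c) = q0"
    using assms(4) by (simp_all add: eq_neg_iff_add_eq_0)
  have "q2 * (a + b + c - a * b * c * cnj d * cnj d' - (d + d'))
      = q2 * (a - d - d') - q1 - a * cnj d * cnj d' * q0"
    using vieta by algebra
  also have "\<dots> = 0" unfolding q2_def q1_def q0_def by algebra
  finally show ?thesis using nz assms(2,3) by (simp add: conjugate_points_def q2_def)
qed

text \<open>The isogonal conjugate \<open>d'\<close> of \<open>D\<close> yields the pedal circle. By
  \<open>chord_foot_on_pedal_circle_iff\<close> a chord has its foot there if and only if \<open>chord_form d d'\<close> vanishes
  on it, and the last clause is then the algebraic porism. \<open>D\<close> lies on the pedal circle if and
  only if \<open>d'\<close> lies on the circumcircle; in that case the form factorises and, unless \<open>D\<close> lies on a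
  side line, all three sides would pass through \<open>d'\<close>. The first conclusions do allow \<open>D\<close> on a side
  line, since a second inscribed triangle may have such a side.\<close>

lemma pedal_circle_of_inscribed_triangle:
  assumes R: "R > 0" and D: "D \<notin> sphere Z R"
    and PQS: "P \<in> sphere Z R" "Q \<in> sphere Z R" "S \<in> sphere Z R" "P \<noteq> Q" "Q \<noteq> S" "S \<noteq> P"
  obtains E r where "r > 0"
    and "foot D (line_through Q S) \<in> sphere E r" "foot D (line_through S P) \<in> sphere E r"
        "foot D (line_through P Q) \<in> sphere E r"
    and "\<not> collinear {foot D (line_through Q S), foot D (line_through S P), foot D (line_through P Q)}"
    and "D \<notin> line_through Q S \<Longrightarrow> D \<notin> line_through S P \<Longrightarrow> D \<notin> line_through P Q \<Longrightarrow> D \<notin> sphere E r"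
    and "\<And>X Y W. \<lbrakk>D \<notin> sphere E r; X \<in> sphere Z R; Y \<in> sphere Z R; W \<in> sphere Z R;
        X \<noteq> Y; X \<noteq> W; Y \<noteq> W; foot D (line_through X Y) \<in> sphere E r;
        foot D (line_through X W) \<in> sphere E r\<rbrakk> \<Longrightarrow> foot D (line_through Y W) \<in> sphere E r"
proof -
  let ?\<phi> = "chart Z R"
  note sph = chart_mem_sphere_iff(2)[OF R]
  obtain a b c d where abc: "P = ?\<phi> a" "Q = ?\<phi> b" "S = ?\<phi> c" and d: "D = ?\<phi> d"
    using chart_surj[OF R] by metis
  have u: "cmod a = 1" "cmod b = 1" "cmod c = 1" and d1: "cmod d \<noteq> 1"
    using PQS D by (simp_all only: abc d sph not_False_eq_True)
  have ne: "a \<noteq> b" "b \<noteq> c" "c \<noteq> a" using PQS(4-6) unfolding abc by blast+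
  obtain d' where d': "conjugate_points d d' a b c" using conjugate_point_exists[OF u d1] .
  define e s where "e = (d + d') / 2" and "s = cmod ((1 - cnj d * d') / 2)"
  let ?C = "sphere (?\<phi> e) (R * s)"
  have foot: "foot D (line_through (?\<phi> x) (?\<phi> y)) = ?\<phi> (chord_foot d x y)"
    if "cmod x = 1" "cmod y = 1" "x \<noteq> y" for x y
    using foot_chord(1)[OF R that] by (simp add: d)
  have on: "foot D (line_through (?\<phi> x) (?\<phi> y)) \<in> ?C \<longleftrightarrow> chord_form d d' x y = 0"
    if "cmod x = 1" "cmod y = 1" "x \<noteq> y" for x y
    unfolding foot[OF that] chart_mem_sphere_iff(1)[OF R] e_def s_def
    using chord_foot_on_pedal_circle_iff[OF that(1,2)] .
  have D_on: "D \<in> ?C \<longleftrightarrow> cmod d' = 1"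
  proof -
    have "D \<in> ?C \<longleftrightarrow> cmod ((d - d') / 2) = cmod ((1 - cnj d * d') / 2)"
    proof -
      have de: "d - e = (d - d') / 2" by (simp add: e_def field_simps)
      show ?thesis by (simp only: d chart_mem_sphere_iff(1)[OF R] s_def de)
    qed
    also have "\<dots> \<longleftrightarrow> (1 - d * cnj d) * (1 - d' * cnj d') = 0"
      by (simp add: norm_divide cmod_eq_iff) algebra
    also have "\<dots> \<longleftrightarrow> cmod d' = 1" using d1 by (auto simp: cmod_eq_1_iff)
    finally show ?thesis .
  qed
  have perm: "conjugate_points d d' b c a" "conjugate_points d d' c a b"
    using d' by (simp_all add: conjugate_points_def algebra_simps)
  have zero: "chord_form d d' b c = 0" "chord_form d d' c a = 0" "chord_form d d' a b = 0"
    using conjugate_points_chord_form u d' perm by blast+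
  have feet: "foot D (line_through Q S) \<in> ?C" "foot D (line_through S P) \<in> ?C"
      "foot D (line_through P Q) \<in> ?C"
    unfolding abc using on u ne zero by simp_all
  \<comment> \<open>The feet on two sides through the vertex \<open>y\<close> could only coincide if \<open>D\<close> were that vertex.\<close>
  have dist: "chord_foot d x y \<noteq> chord_foot d y z" if "cmod y = 1" "x \<noteq> z" for x y z
  proof
    assume "chord_foot d x y = chord_foot d y z"
    then have "(x - z) * (1 - y * cnj d) = 0" unfolding chord_foot_def by (simp, algebra)
    then have "y * cnj d = 1" using that(2) by simp
    then have "cmod (y * cnj d) = 1" by simp
    then show False using that(1) d1 by (simp add: norm_mult)
  qed
  have feet_ne: "foot D (line_through Q S) \<noteq> foot D (line_through S P)"
    "foot D (line_through Q S) \<noteq> foot D (line_through P Q)"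
    "foot D (line_through S P) \<noteq> foot D (line_through P Q)"
    unfolding abc foot[OF u(2,3) ne(2)] foot[OF u(3,1) ne(3)] foot[OF u(1,2) ne(1)]
    using dist[of c b a] dist[of b a c] dist[of a c b] u ne by (auto simp: chart_eq_iff[OF R])
  show thesis
  proof (rule that[of "R * s" "?\<phi> e"])
    have "R * s \<noteq> 0"
    proof
      assume Rs: "R * s = 0"
      show False using feet(1,2) feet_ne(1) unfolding Rs by simp
    qed
    then show "R * s > 0" using R by (simp add: s_def)
    show "\<not> collinear {foot D (line_through Q S), foot D (line_through S P), foot D (line_through P Q)}"
      by (rule sphere_noncollinear[OF feet feet_ne])
  next
    assume D_sides: "D \<notin> line_through Q S" "D \<notin> line_through S P" "D \<notin> line_through P Q"
    show "D \<notin> ?C"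
    proof
      assume "D \<in> ?C"
      then have d'1: "d' * cnj d' = 1" using D_on by (simp add: cmod_eq_1_iff)
      have g: "x + y - d' - cnj d' * x * y = 0"
        if "cmod x = 1" "cmod y = 1" "x \<noteq> y" "D \<notin> line_through (?\<phi> x) (?\<phi> y)"
          "chord_form d d' x y = 0" for x y
      proof -
        have "chord_foot d x y \<noteq> d" using that(4) foot_chord(2)[OF R that(1-3), where Z = Z and d = d] d by auto
        then have "x + y - d - cnj d * x * y \<noteq> 0" by (auto simp: chord_foot_def algebra_simps)
        then show ?thesis using that(5) d'1 by (simp add: chord_form_def)
      qed
      have 1: "b + c - d' - cnj d' * b * c = 0" and 2: "c + a - d' - cnj d' * c * a = 0"
        and 3: "a + b - d' - cnj d' * a * b = 0"
        using g u ne zero D_sides unfolding abc by blast+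
      have "(b - a) * (1 - cnj d' * c) = 0" "(c - a) * (1 - cnj d' * b) = 0"
        using 1 2 3 by algebra+
      then have "cnj d' * c = 1" "cnj d' * b = 1" using ne by simp_all
      then have "b = c" using d'1 by algebra
      then show False using ne by simp
    qed
  next
    fix X Y W
    assume XYW: "D \<notin> ?C" "X \<in> sphere Z R" "Y \<in> sphere Z R" "W \<in> sphere Z R"
        "X \<noteq> Y" "X \<noteq> W" "Y \<noteq> W" "foot D (line_through X Y) \<in> ?C" "foot D (line_through X W) \<in> ?C"
    obtain x y w where xyw: "X = ?\<phi> x" "Y = ?\<phi> y" "W = ?\<phi> w" using chart_surj[OF R] by metis
    have v: "cmod x = 1" "cmod y = 1" "cmod w = 1"
      using XYW(2-4) by (simp_all only: xyw sph)
    have vne: "x \<noteq> y" "x \<noteq> w" "y \<noteq> w" using XYW(5-7) by (auto simp: xyw)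
    have "chord_form d d' x y = 0" "chord_form d d' x w = 0"
      using XYW(8,9) on v vne unfolding xyw by blast+
    then have "conjugate_points d d' x y w"
      using chord_form_porism[OF v(1) d1 _ vne(3)] D_on XYW(1) by blast
    then have "conjugate_points d d' y w x" by (simp add: conjugate_points_def algebra_simps)
    then show "foot D (line_through Y W) \<in> ?C"
      using conjugate_points_chord_form v on vne unfolding xyw by blast
  qed (use feet in simp_all)
qed

section \<open>The porism\<close>

theorem proposition4:
  fixes A B C D :: plane
  assumes "is_triangle A B C"
    and "D \<notin> line_through B C" and "D \<notin> line_through C A" and "D \<notin> line_through A B"
    and "D \<notin> circumcircle A B C"
  shows "poristic3 (circumcircle A B C) (i_conic D A B C) \<and>
         (\<forall>P Q R. is_triangle P Q R \<and> inscribed P Q R (circumcircle A B C) \<longrightarrow>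
            (pedal_circle D P Q R = pedal_circle D A B C \<longleftrightarrow>
             circumscribed P Q R (i_conic D A B C)))"
proof -
  have ABC: "\<not> collinear {A, B, C}" using assms(1) by (simp add: is_triangle_def)
  then have ne: "A \<noteq> B" "B \<noteq> C" "C \<noteq> A" by (auto simp: insert_commute)
  obtain Z \<sigma> where \<sigma>: "\<sigma> > 0" and in\<sigma>: "A \<in> sphere Z \<sigma>" "B \<in> sphere Z \<sigma>" "C \<in> sphere Z \<sigma>"
    using circumcircle_exists[OF ABC] .
  have circ: "circumcircle A B C = sphere Z \<sigma>" by (rule circumcircle_eq_sphere[OF ABC \<sigma> in\<sigma>])
  have D: "D \<notin> sphere Z \<sigma>" using assms(5) by (simp add: circ)
  obtain E r where r: "r > 0"
    and feet: "foot D (line_through B C) \<in> sphere E r" "foot D (line_through C A) \<in> sphere E r"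
        "foot D (line_through A B) \<in> sphere E r"
    and nc: "\<not> collinear {foot D (line_through B C), foot D (line_through C A), foot D (line_through A B)}"
    and D': "D \<notin> line_through B C \<Longrightarrow> D \<notin> line_through C A \<Longrightarrow> D \<notin> line_through A B \<Longrightarrow> D \<notin> sphere E r"
    and porism: "\<And>X Y W. \<lbrakk>D \<notin> sphere E r; X \<in> sphere Z \<sigma>; Y \<in> sphere Z \<sigma>; W \<in> sphere Z \<sigma>;
        X \<noteq> Y; X \<noteq> W; Y \<noteq> W; foot D (line_through X Y) \<in> sphere E r;
        foot D (line_through X W) \<in> sphere E r\<rbrakk> \<Longrightarrow> foot D (line_through Y W) \<in> sphere E r"
    by (rule pedal_circle_of_inscribed_triangle[OF \<sigma> D in\<sigma> ne]) blast
  have DE: "D \<notin> sphere E r" using D' assms(2-4) by blast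
  define K where "K = pedal_conic D E r"
  note tangent = tangent_to_pedal_conic_iff[OF r DE, folded K_def]
  have line: "is_line (line_through X Y)" if "X \<noteq> Y" for X Y using that by (auto simp: is_line_def)
  obtain w \<rho> where \<rho>: "\<rho> > 0" and K_focal: "K = focal_conic D w \<rho>"
  proof
    show "K = focal_conic D ((1 / ((E - D) \<bullet> (E - D) - r\<^sup>2)) *\<^sub>R (E - D))
        (r / \<bar>(E - D) \<bullet> (E - D) - r\<^sup>2\<bar>)"
      by (simp add: K_def pedal_conic_def Let_def)
  qed (use power_of_point_ne_0[OF r DE] r in simp)
  have KABC: "circumscribed A B C K"
    using feet ne by (simp add: circumscribed_def tangent line)
  have K: "i_conic D A B C = K"
    unfolding i_conic_def
  proof (rule the_equality)
    show "is_conic K \<and> has_focus K D \<and> circumscribed A B C K"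
      using KABC is_conic_focal_conic[OF \<rho>] \<rho> by (auto simp: K_focal has_focus_iff_focal_conic)
    fix L assume L: "is_conic L \<and> has_focus L D \<and> circumscribed A B C L"
    then obtain w' \<rho>' where \<rho>': "\<rho>' > 0" and L': "L = focal_conic D w' \<rho>'"
      by (auto simp: has_focus_iff_focal_conic)
    show "L = K"
      unfolding L' K_focal
      by (rule tangent_lines_determine_focal_conic[OF r \<rho>' \<rho> _ _ nc feet])
        (use L KABC in \<open>auto simp: L' K_focal circumscribed_def\<close>)
  qed
  have "poristic3 (sphere Z \<sigma>) K"
    unfolding poristic3_def
  proof (intro conjI allI impI)
    have "sphere Z \<sigma> = focal_conic Z 0 (1 / \<sigma>)"
      using \<sigma> by (auto simp: focal_conic_def dist_commute field_simps)
    then show "is_conic (sphere Z \<sigma>)" using is_conic_focal_conic[of "1 / \<sigma>" Z 0] \<sigma> by simp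
    show "is_conic K" using is_conic_focal_conic[OF \<rho>] by (simp add: K_focal)
    fix X Y W l m
    assume *: "X \<in> sphere Z \<sigma> \<and> tangent_to l K \<and> tangent_to m K \<and> l \<noteq> m \<and> X \<in> l \<and> X \<in> m \<and>
      Y \<in> l \<inter> sphere Z \<sigma> \<and> W \<in> m \<inter> sphere Z \<sigma> \<and> X \<noteq> Y \<and> X \<noteq> W \<and> Y \<noteq> W"
    then have "is_line l" "is_line m" by (auto simp: tangent_to_def)
    then have "l = line_through X Y" "m = line_through X W"
      using * line_eq_line_through by blast+
    then have "foot D (line_through X Y) \<in> sphere E r" "foot D (line_through X W) \<in> sphere E r"
      using * tangent \<open>is_line l\<close> \<open>is_line m\<close> by blast+
    then have "foot D (line_through Y W) \<in> sphere E r"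
      using porism[OF DE] * by blast
    then show "tangent_to (line_through Y W) K" using tangent line * by blast
  qed
  moreover have "pedal_circle D P Q S = pedal_circle D A B C \<longleftrightarrow> circumscribed P Q S K"
    if PQS: "is_triangle P Q S" "inscribed P Q S (sphere Z \<sigma>)" for P Q S
  proof -
    have PQS_ne: "P \<noteq> Q" "Q \<noteq> S" "S \<noteq> P" using PQS(1) by (auto simp: is_triangle_def insert_commute)
    have PQS_in: "P \<in> sphere Z \<sigma>" "Q \<in> sphere Z \<sigma>" "S \<in> sphere Z \<sigma>"
      using PQS(2) by (simp_all add: inscribed_def)
    let ?f1 = "foot D (line_through Q S)" and ?f2 = "foot D (line_through S P)"
      and ?f3 = "foot D (line_through P Q)"
    \<comment> \<open>The three sides are tangent exactly if the three feet lie on the pedal circle of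
        \<open>A B C\<close>; since the feet are not collinear, this means that the pedal circles coincide.\<close>
    have "circumscribed P Q S K \<longleftrightarrow> ?f1 \<in> sphere E r \<and> ?f2 \<in> sphere E r \<and> ?f3 \<in> sphere E r"
      using PQS_ne by (simp only: circumscribed_def tangent[OF line] not_False_eq_True)
    moreover have "pedal_circle D A B C = sphere E r"
      unfolding pedal_circle_def by (rule circumcircle_eq_sphere[OF nc r feet])
    moreover obtain E' r' where r': "r' > 0"
      and f': "?f1 \<in> sphere E' r'" "?f2 \<in> sphere E' r'" "?f3 \<in> sphere E' r'"
      and nc': "\<not> collinear {?f1, ?f2, ?f3}"
      by (rule pedal_circle_of_inscribed_triangle[OF \<sigma> D PQS_in PQS_ne]) blast
    moreover have "pedal_circle D P Q S = sphere E' r'"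
      unfolding pedal_circle_def by (rule circumcircle_eq_sphere[OF nc' r' f'])
    ultimately show ?thesis
      using sphere_unique[OF nc' r' r f'] by blast
  qed
  ultimately show ?thesis unfolding circ K by blast
qed

end
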